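(* Set $a:=\sqrt3$ and let $F_0$ be the uniform distribution on $[-a,a]$. For $\theta\ge0$ let $$F_\theta(dx)=e^{\theta x-\psi(\theta)}F_0(dx),\qquad \psi(\theta):=\log\int_{\mathbb{R}}e^{\theta x}\,F_0(dx),$$ and let $X_1,X_2,\dots$ be i.i.d. with law $F_\theta$ under $\mathbb{P}_\theta$. Then for every $k>1$ there exist $b\in(0,a)$ and $\theta_0>0$ such that for all $\theta\ge\theta_0$ the inequality $$\mathbb{E}_\theta\left[R_b^{\,k}\right]\ \le\ \frac{\mathbb{E}_\theta\left[(X_1^+)^{k+1}\right]}{k\,\mu_\theta}$$ fails.
   Context: $\mathbb{E}_\theta$ is expectation under $\mathbb{P}_\theta$ and $\mu_\theta=\mathbb{E}_\theta[X_1]$, which is $>0$ for $\theta>0$. $S_0=0$, $S_n=X_1+\dots+X_n$; for $b\ge0$, $\tau(b)=\inf\{n\ge1:S_n>b\}$ and $R_b=S_{\tau(b)}-b$. $x^+=\max\{x,0\}$. *)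

theory Defs
  imports "HOL-Probability.Probability"
begin

definition cumulant :: "real measure \<Rightarrow> real \<Rightarrow> real" where
  "cumulant F \<theta> = ln (\<integral>x. exp (\<theta> * x) \<partial>F)"

definition exp_tilt :: "real measure \<Rightarrow> real \<Rightarrow> real measure" where
  "exp_tilt F \<theta> = density F (\<lambda>x. ennreal (exp (\<theta> * x - cumulant F \<theta>)))"

definition F0 :: "real measure" where
  "F0 = uniform_measure lborel {- sqrt 3..sqrt 3}"

text \<open>The increments are \<open>X 1, X 2, \<dots>\<close>; the value of \<open>X\<close> at index 0 is never used.\<close>

definition partial_sum :: "(nat \<Rightarrow> 'a \<Rightarrow> real) \<Rightarrow> nat \<Rightarrow> 'a \<Rightarrow> real" where
  "partial_sum X n \<omega> = (\<Sum>i=1..n. X i \<omega>)"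

definition passage_time :: "(nat \<Rightarrow> 'a \<Rightarrow> real) \<Rightarrow> real \<Rightarrow> 'a \<Rightarrow> enat" where
  "passage_time X b \<omega> = Inf {enat n |n. 1 \<le> n \<and> partial_sum X n \<omega> > b}"

text \<open>
  The overshoot is set to 0 on the event that the level is never crossed. This event is null
  whenever the increments are i.i.d. with positive mean.
\<close>

definition overshoot :: "(nat \<Rightarrow> 'a \<Rightarrow> real) \<Rightarrow> real \<Rightarrow> 'a \<Rightarrow> real" where
  "overshoot X b \<omega> =
    (case passage_time X b \<omega> of enat n \<Rightarrow> partial_sum X n \<omega> - b | \<infinity> \<Rightarrow> 0)"

end

theory Submission
  imports Defs
begin

text \<open>
  As \<open>\<theta>\<close> grows, \<open>F\<^sub>\<theta>\<close> concentrates at the right end point \<open>a = sqrt 3\<close>. For fixed \<open>b < a\<close> the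
  level is then crossed at the first step with overshoot close to \<open>a - b\<close>, so the left-hand side
  has limit inferior at least \<open>(a - b)\<^sup>k\<close>, while the right-hand side tends to \<open>a\<^sup>k / k\<close>. Since
  \<open>k > 1\<close>, the former exceeds the latter for small \<open>b\<close>.
\<close>

section \<open>Pathwise facts on the passage time and the overshoot\<close>

text \<open>The infimum of the empty set in \<open>enat\<close> is \<open>\<infinity>\<close>, and a
  nonempty set contains its infimum by well-ordering; hence a finite passage time is an actual first
  crossing.\<close>

lemma passage_time_enatD:
  assumes "passage_time X b \<omega> = enat n"
  shows "1 \<le> n" "partial_sum X n \<omega> > b"
    and "\<And>m. 1 \<le> m \<Longrightarrow> m < n \<Longrightarrow> partial_sum X m \<omega> \<le> b"
proof -
  let ?A = "{enat n |n. 1 \<le> n \<and> partial_sum X n \<omega> > b}"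
  have eq: "Inf ?A = enat n" using assms by (simp add: passage_time_def)
  then have "?A \<noteq> {}" by (metis Inf_empty enat.distinct(2) top_enat_def)
  then obtain x where "x \<in> ?A" by blast
  then have "Inf ?A \<in> ?A" by (rule wellorder_InfI)
  then have "enat n \<in> ?A" unfolding eq .
  then show "1 \<le> n" "partial_sum X n \<omega> > b" by auto
  show "partial_sum X m \<omega> \<le> b" if "1 \<le> m" "m < n" for m
  proof (rule ccontr)
    assume "\<not> partial_sum X m \<omega> \<le> b"
    then have "enat m \<in> ?A" using that by auto
    then have "Inf ?A \<le> enat m" by (rule Inf_lower)
    then show False using that eq by simp
  qed
qed

lemma passage_time_eq_1:
  assumes "X 1 \<omega> > b"
  shows "passage_time X b \<omega> = enat 1"
  unfolding passage_time_def
proof (rule antisym)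
  show "Inf {enat n |n. 1 \<le> n \<and> partial_sum X n \<omega> > b} \<le> enat 1"
    using assms by (intro Inf_lower) (auto simp: partial_sum_def)
qed (auto intro!: Inf_greatest)

lemma overshoot_first_step: "X 1 \<omega> > b \<Longrightarrow> overshoot X b \<omega> = X 1 \<omega> - b"
  using passage_time_eq_1[of b X \<omega>] by (simp add: overshoot_def partial_sum_def)

lemma overshoot_nonneg: "0 \<le> overshoot X b \<omega>"
  by (auto simp: overshoot_def split: enat.splits dest: passage_time_enatD(2))

text \<open>Just before crossing the walk is at most \<open>b\<close>, so the overshoot is no larger
  than the crossing increment. The bound later makes powers of the overshoot integrable; without
  integrability the Bochner integral would default to 0 and no lower bound would follow.\<close>

lemma overshoot_le:
  assumes "0 \<le> a" "0 \<le> b" and le: "\<And>n. 1 \<le> n \<Longrightarrow> X n \<omega> \<le> a"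
  shows "overshoot X b \<omega> \<le> a"
proof (cases "passage_time X b \<omega>")
  case (enat n)
  note n = passage_time_enatD[OF enat]
  obtain m where m: "n = Suc m" using n(1) by (cases n) auto
  have "partial_sum X m \<omega> \<le> b"
    \<comment> \<open>Minimality of \<open>n\<close> speaks only of indices from 1 on; for
      \<open>m = 0\<close> the sum is empty and \<open>0 \<le> b\<close> is used instead.\<close>
    using n(3)[of m] m assms(2) by (cases "m = 0") (auto simp: partial_sum_def)
  moreover have "partial_sum X n \<omega> = partial_sum X m \<omega> + X n \<omega>"
    unfolding m partial_sum_def by simp
  ultimately show ?thesis using le[OF n(1)] enat by (simp add: overshoot_def)
qed (use assms in \<open>simp add: overshoot_def\<close>)

section \<open>Measurability of the walk, the passage time and the overshoot\<close>

lemma borel_measurable_partial_sum: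
  assumes "\<And>n. 1 \<le> n \<Longrightarrow> X n \<in> borel_measurable M"
  shows "partial_sum X n \<in> borel_measurable M"
proof -
  have "(\<lambda>\<omega>. \<Sum>i=1..n. X i \<omega>) \<in> borel_measurable M"
    by (rule borel_measurable_sum) (use assms in auto)
  moreover have "partial_sum X n = (\<lambda>\<omega>. \<Sum>i=1..n. X i \<omega>)"
    by (auto simp: partial_sum_def)
  ultimately show ?thesis by simp
qed

lemma measurable_passage_time:
  assumes "\<And>n. 1 \<le> n \<Longrightarrow> X n \<in> borel_measurable M"
  shows "passage_time X b \<in> measurable M (count_space UNIV)"
proof -
  note [measurable] = borel_measurable_partial_sum[where X=X and M=M, OF assms]
  \<comment> \<open>The set under the infimum varies with \<open>\<omega>\<close>. Giving the value
    \<open>\<infinity>\<close> to indices without crossing turns it into an infimum over a fixed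
    countable index set, which preserves measurability.\<close>
  have eq: "passage_time X b \<omega> =
      (INF n\<in>{1..}. if partial_sum X n \<omega> > b then enat n else \<infinity>)" for \<omega>
    unfolding passage_time_def
  proof (rule antisym)
    show "Inf {enat n |n. 1 \<le> n \<and> partial_sum X n \<omega> > b}
        \<le> (INF n\<in>{1..}. if partial_sum X n \<omega> > b then enat n else \<infinity>)"
      by (rule INF_greatest) (auto intro: Inf_lower)
    show "(INF n\<in>{1..}. if partial_sum X n \<omega> > b then enat n else \<infinity>)
        \<le> Inf {enat n |n. 1 \<le> n \<and> partial_sum X n \<omega> > b}"
    proof (rule Inf_greatest)
      fix x assume "x \<in> {enat n |n. 1 \<le> n \<and> partial_sum X n \<omega> > b}"
      then obtain n where "x = enat n" "1 \<le> n" "partial_sum X n \<omega> > b" by blast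
      then show "(INF n\<in>{1..}. if partial_sum X n \<omega> > b then enat n else \<infinity>) \<le> x"
        by (intro INF_lower2[of n]) auto
    qed
  qed
  have "(\<lambda>\<omega>. INF n\<in>{1..}. if partial_sum X n \<omega> > b then enat n else \<infinity>)
      \<in> measurable M (count_space UNIV)"
    by (rule measurable_INF) auto
  then show ?thesis using eq by (simp cong: measurable_cong)
qed

text \<open>The walk is evaluated at a random index, but \<open>enat\<close> is countable, so it is
  enough to treat each fixed value of the passage time.\<close>

lemma borel_measurable_overshoot:
  assumes "\<And>n. 1 \<le> n \<Longrightarrow> X n \<in> borel_measurable M"
  shows "overshoot X b \<in> borel_measurable M"
proof -
  note [measurable] = borel_measurable_partial_sum[where X=X and M=M, OF assms]
  have "(\<lambda>\<omega>. case passage_time X b \<omega> of enat n \<Rightarrow> partial_sum X n \<omega> - b | \<infinity> \<Rightarrow> 0)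
      \<in> borel_measurable M"
  proof (rule measurable_compose_countable[OF _ measurable_passage_time[OF assms]])
    fix i :: enat
    show "(\<lambda>\<omega>. case i of enat n \<Rightarrow> partial_sum X n \<omega> - b | \<infinity> \<Rightarrow> 0) \<in> borel_measurable M"
      by (cases i) auto
  qed auto
  then show ?thesis by (simp add: overshoot_def[abs_def])
qed

section \<open>The uniform law and the concentration of its exponential tilts\<close>

lemma prob_space_F0: "prob_space F0"
  unfolding F0_def by (rule prob_space_uniform_measure) auto

lemma sets_F0 [measurable_cong]: "sets F0 = sets borel"
  by (simp add: F0_def)

lemma space_F0 [simp]: "space F0 = UNIV"
  by (simp add: F0_def)

lemma AE_F0: "AE x in F0. \<bar>x\<bar> \<le> sqrt 3"
  unfolding F0_def by (rule AE_uniform_measureI) auto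

text \<open>\<open>F0\<close> charges every left neighbourhood of its right end point; this is what
  forces its tilts to concentrate there.\<close>

lemma measure_F0_pos:
  assumes "0 < d" "d < sqrt 3"
  shows "0 < measure F0 {d..}"
proof -
  have "{- sqrt 3..sqrt 3} \<inter> {d..} = {d..sqrt 3}" using assms by auto
  then have "measure F0 {d..} = (sqrt 3 - d) / (2 * sqrt 3)"
    unfolding F0_def using assms
    by (subst measure_uniform_measure) auto
  then show ?thesis using assms by simp
qed

lemma AE_exp_tilt_F0: "AE x in exp_tilt F0 \<theta>. \<bar>x\<bar> \<le> sqrt 3"
  unfolding exp_tilt_def using AE_F0 by (subst AE_density) auto

lemma integrable_exp_F0: "integrable F0 (\<lambda>x. exp (\<theta> * x))"
proof -
  interpret prob_space F0 by (rule prob_space_F0)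
  have "AE x in F0. norm (exp (\<theta> * x)) \<le> exp (\<bar>\<theta>\<bar> * sqrt 3)"
    using AE_F0
  proof eventually_elim
    case (elim x)
    have "\<theta> * x \<le> \<bar>\<theta>\<bar> * \<bar>x\<bar>" by (simp flip: abs_mult)
    also have "\<dots> \<le> \<bar>\<theta>\<bar> * sqrt 3" using elim by (intro mult_left_mono) auto
    finally show ?case by simp
  qed
  then show ?thesis by (rule integrable_const_bound) measurable
qed

text \<open>An exponential Markov bound: only the mass on \<open>{d..}\<close> is kept, where the
  integrand is at least \<open>exp (\<theta> * d)\<close>.\<close>

lemma mgf_F0_ge:
  assumes "0 \<le> \<theta>"
  shows "exp (\<theta> * d) * measure F0 {d..} \<le> (\<integral>x. exp (\<theta> * x) \<partial>F0)"
proof -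
  interpret prob_space F0 by (rule prob_space_F0)
  have "(\<integral>x. exp (\<theta> * d) * indicator {d..} x \<partial>F0) \<le> (\<integral>x. exp (\<theta> * x) \<partial>F0)"
  proof (rule integral_mono[OF _ integrable_exp_F0])
    show "integrable F0 (\<lambda>x. exp (\<theta> * d) * indicator {d..} x :: real)"
      by (intro integrable_mult_right integrable_real_indicator) (auto simp: sets_F0 emeasure_eq_measure)
    show "exp (\<theta> * d) * indicator {d..} x \<le> exp (\<theta> * x)" for x
      using assms by (auto simp: indicator_def mult_left_mono)
  qed
  then show ?thesis by simp
qed

text \<open>On \<open>{..c}\<close> the tilted density is at most \<open>exp (\<theta> * c)\<close>
  divided by the normalising constant, which is at least \<open>exp (\<theta> * d)\<close> times the
  mass of \<open>{d..}\<close>. For \<open>c < d\<close> the bound decays exponentially in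
  \<open>\<theta>\<close>.\<close>

lemma emeasure_exp_tilt_F0_le:
  assumes "0 \<le> \<theta>" "0 < d" "d < sqrt 3"
  shows "emeasure (exp_tilt F0 \<theta>) {..c} \<le> ennreal (exp (\<theta> * (c - d)) / measure F0 {d..})"
proof -
  interpret prob_space F0 by (rule prob_space_F0)
  define Z where "Z = (\<integral>x. exp (\<theta> * x) \<partial>F0)"
  define q where "q = measure F0 {d..}"
  have q: "0 < q" using measure_F0_pos[OF assms(2,3)] by (simp add: q_def)
  have Z: "exp (\<theta> * d) * q \<le> Z" using mgf_F0_ge[OF assms(1)] by (simp add: Z_def q_def)
  have "0 < exp (\<theta> * d) * q" using q by simp
  \<comment> \<open>Positivity of \<open>Z\<close> lets the exponential undo the logarithm in
    \<open>cumulant\<close>.\<close>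
  then have Zpos: "0 < Z" using Z by linarith
  have tilt: "exp (\<theta> * x - cumulant F0 \<theta>) = exp (\<theta> * x) / Z" for x
    using Zpos by (simp add: cumulant_def exp_diff Z_def)
  have "emeasure (exp_tilt F0 \<theta>) {..c} = (\<integral>\<^sup>+x. ennreal (exp (\<theta> * x) / Z) * indicator {..c} x \<partial>F0)"
    unfolding exp_tilt_def tilt by (rule emeasure_density) (auto simp: sets_F0)
  also have "\<dots> \<le> (\<integral>\<^sup>+x. ennreal (exp (\<theta> * (c - d)) / q) \<partial>F0)"
  proof (rule nn_integral_mono)
    fix x
    have "exp (\<theta> * x) / Z \<le> exp (\<theta> * (c - d)) / q" if "x \<le> c"
    proof -
      have "exp (\<theta> * x) / Z \<le> exp (\<theta> * c) / (exp (\<theta> * d) * q)"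
        using that assms(1) Z q by (intro frac_le) (auto simp: mult_left_mono)
      also have "\<dots> = exp (\<theta> * (c - d)) / q" by (simp add: right_diff_distrib exp_diff)
      finally show ?thesis .
    qed
    then show "ennreal (exp (\<theta> * x) / Z) * indicator {..c} x \<le> ennreal (exp (\<theta> * (c - d)) / q)"
      by (auto simp: indicator_def intro: ennreal_leI)
  qed
  also have "\<dots> = ennreal (exp (\<theta> * (c - d)) / q)"
    using emeasure_space_1 by simp
  finally show ?thesis by (simp add: q_def)
qed

lemma exp_tilt_F0_concentrates:
  assumes "c < sqrt 3" "0 < \<epsilon>"
  obtains \<theta>0 where "0 < \<theta>0" "\<And>\<theta>. \<theta>0 \<le> \<theta> \<Longrightarrow> emeasure (exp_tilt F0 \<theta>) {..c} \<le> ennreal \<epsilon>"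
proof -
  \<comment> \<open>\<open>d\<close> lies above \<open>c\<close> to make the exponent
    \<open>\<theta> * (c - d)\<close> tend to minus infinity, and above 0 to meet the condition of
    \<open>measure_F0_pos\<close>.\<close>
  obtain d where d: "max 0 c < d" "d < sqrt 3" using dense[of "max 0 c" "sqrt 3"] assms by auto
  define q where "q = measure F0 {d..}"
  have q: "0 < q" using measure_F0_pos[of d] d by (simp add: q_def)
  have "((\<lambda>\<theta>. exp (\<theta> * (c - d)) / q) \<longlongrightarrow> 0 / q) at_top"
  proof (intro tendsto_divide tendsto_const)
    have "filterlim (\<lambda>\<theta>. (c - d) * \<theta>) at_bot at_top"
      using d by (intro filterlim_tendsto_neg_mult_at_bot[OF tendsto_const _ filterlim_ident]) auto
    then have "filterlim (\<lambda>\<theta>. \<theta> * (c - d)) at_bot at_top" by (simp add: mult.commute)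
    then show "((\<lambda>\<theta>. exp (\<theta> * (c - d))) \<longlongrightarrow> 0) at_top"
      by (rule filterlim_compose[OF exp_at_bot])
  qed (use q in auto)
  then have "eventually (\<lambda>\<theta>. exp (\<theta> * (c - d)) / q < \<epsilon>) at_top"
    using assms(2) by (intro order_tendstoD(2)) auto
  then obtain N where N: "\<And>\<theta>. N \<le> \<theta> \<Longrightarrow> exp (\<theta> * (c - d)) / q < \<epsilon>"
    by (auto simp: eventually_at_top_linorder)
  show ?thesis
  proof (rule that[of "max N 1"])
    fix \<theta> assume \<theta>: "max N 1 \<le> \<theta>"
    have "emeasure (exp_tilt F0 \<theta>) {..c} \<le> ennreal (exp (\<theta> * (c - d)) / q)"
      unfolding q_def using d \<theta> by (intro emeasure_exp_tilt_F0_le) auto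
    also have "\<dots> \<le> ennreal \<epsilon>" using N[of \<theta>] \<theta> by (intro ennreal_leI) auto
    finally show "emeasure (exp_tilt F0 \<theta>) {..c} \<le> ennreal \<epsilon>" .
  qed simp
qed

section \<open>Choice of the level and of the degree of concentration\<close>

text \<open>At \<open>b = 0\<close> the inequality reads \<open>a powr k < k * a powr k\<close>,
  true since \<open>k > 1\<close>; continuity in \<open>b\<close> carries it to small positive
  levels.\<close>

lemma exists_level:
  fixes k a :: real
  assumes "1 < k" "0 < a"
  obtains b where "0 < b" "b < a" "a powr k < k * (a - b) powr k"
proof -
  have "((\<lambda>b. k * (a - b) powr k) \<longlongrightarrow> k * (a - 0) powr k) (at_right 0)"
    using assms by (intro tendsto_intros) auto
  moreover have "a powr k < k * (a - 0) powr k" using assms by simp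
  ultimately have "eventually (\<lambda>b. a powr k < k * (a - b) powr k) (at_right 0)"
    by (rule order_tendstoD(1))
  moreover have "eventually (\<lambda>b. b \<in> {0<..<a}) (at_right 0)"
    using assms(2) by (rule eventually_at_right_real)
  ultimately have "eventually (\<lambda>b. b \<in> {0<..<a} \<and> a powr k < k * (a - b) powr k) (at_right 0)"
    by eventually_elim auto
  then obtain b where "b \<in> {0<..<a}" "a powr k < k * (a - b) powr k"
    using eventually_happens'[OF trivial_limit_at_right_real] by blast
  then show ?thesis using that by auto
qed

text \<open>The parameter \<open>t\<close> is both the distance from the end point \<open>a\<close>
  and the mass tolerated below \<open>a - t\<close>. The factor
  \<open>(1 - t) * (a - t - b) powr k\<close> will bound the overshoot moment from below, and
  \<open>(a - t) * (1 - t) - a * t\<close> the mean. At \<open>t = 0\<close> the last inequality is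
  the third assumption times \<open>a\<close>, so it persists for small \<open>t\<close> by
  continuity.\<close>

lemma exists_concentration:
  fixes a b k :: real
  assumes "b < a" "0 < a" "a powr k < k * (a - b) powr k"
  obtains t where "0 < t" "t < 1" "t < a - b" "0 < (a - t) * (1 - t) - a * t"
    "a powr (k + 1) < k * ((1 - t) * (a - t - b) powr k) * ((a - t) * (1 - t) - a * t)"
proof -
  let ?\<mu> = "\<lambda>t::real. (a - t) * (1 - t) - a * t"
  let ?g = "\<lambda>t::real. k * ((1 - t) * (a - t - b) powr k) * ?\<mu> t"
  have "(?g \<longlongrightarrow> ?g 0) (at_right 0)"
    using assms by (intro tendsto_intros) auto
  moreover have "a powr (k + 1) < ?g 0"
    using mult_strict_right_mono[OF assms(3,2)] assms(2) by (simp add: powr_add)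
  ultimately have "eventually (\<lambda>t. a powr (k + 1) < ?g t) (at_right 0)"
    by (rule order_tendstoD(1))
  moreover have "(?\<mu> \<longlongrightarrow> ?\<mu> 0) (at_right 0)" by (intro tendsto_intros)
  then have "eventually (\<lambda>t. 0 < ?\<mu> t) (at_right 0)"
    by (rule order_tendstoD(1)) (use assms in auto)
  moreover have "eventually (\<lambda>t. t \<in> {0<..<min 1 (a - b)}) (at_right 0)"
    using assms(1) by (intro eventually_at_right_real) auto
  ultimately have "eventually (\<lambda>t. t \<in> {0<..<min 1 (a - b)} \<and> 0 < ?\<mu> t \<and> a powr (k + 1) < ?g t) (at_right 0)"
    by eventually_elim auto
  then obtain t where "t \<in> {0<..<min 1 (a - b)}" "0 < ?\<mu> t" "a powr (k + 1) < ?g t"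
    using eventually_happens'[OF trivial_limit_at_right_real] by blast
  then show ?thesis using that by auto
qed

section \<open>Moment bounds for bounded, concentrated increments\<close>

text \<open>Markov's inequality for \<open>Y + a\<close>, which is almost surely nonnegative and
  exceeds \<open>c + a\<close> on the event \<open>c < Y\<close>.\<close>

lemma (in prob_space) expectation_ge_of_concentrated:
  assumes [measurable]: "Y \<in> borel_measurable M" and "AE \<omega> in M. \<bar>Y \<omega>\<bar> \<le> a"
    and "0 \<le> c + a" and p: "p \<le> prob {\<omega> \<in> space M. c < Y \<omega>}"
  shows "c * p - a * (1 - p) \<le> expectation Y"
proof -
  let ?A = "{\<omega> \<in> space M. c < Y \<omega>}"
  have int: "integrable M Y" using assms(2) by (intro integrable_const_bound[where B=a]) auto
  have "(c + a) * p \<le> (c + a) * prob ?A" using p assms(3) by (rule mult_left_mono)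
  also have "\<dots> = (\<integral>\<omega>. (c + a) * indicator ?A \<omega> \<partial>M)" by simp
  also have "\<dots> \<le> (\<integral>\<omega>. Y \<omega> + a \<partial>M)"
  proof (rule integral_mono_AE)
    show "AE \<omega> in M. (c + a) * indicator ?A \<omega> \<le> Y \<omega> + a"
      using assms(2) by eventually_elim (auto simp: indicator_def)
  qed (use int in \<open>auto simp: emeasure_eq_measure\<close>)
  also have "\<dots> = expectation Y + a" using int by (simp add: prob_space)
  finally show ?thesis by (simp add: algebra_simps)
qed

text \<open>If the first increment exceeds \<open>c > b\<close>, the level is crossed at once with
  overshoot above \<open>c - b\<close>; elsewhere the power of the overshoot is nonnegative.\<close>

lemma (in prob_space) expectation_overshoot_powr_ge:
  assumes X: "\<And>n. 1 \<le> n \<Longrightarrow> X n \<in> borel_measurable M"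
    and bd: "\<And>n. 1 \<le> n \<Longrightarrow> AE \<omega> in M. X n \<omega> \<le> a"
    and "0 \<le> a" "0 \<le> b" "b < c" "0 \<le> k"
  shows "prob {\<omega> \<in> space M. c < X 1 \<omega>} * (c - b) powr k \<le> expectation (\<lambda>\<omega>. overshoot X b \<omega> powr k)"
proof -
  let ?A = "{\<omega> \<in> space M. c < X 1 \<omega>}"
  have [measurable]: "X 1 \<in> borel_measurable M" using X by simp
  have [measurable]: "overshoot X b \<in> borel_measurable M" using X by (rule borel_measurable_overshoot)
  \<comment> \<open>The crossing index is random, so the bounds must hold for all steps outside a
    single null set.\<close>
  have "AE \<omega> in M. \<forall>n. 1 \<le> n \<longrightarrow> X n \<omega> \<le> a" using bd by (subst AE_all_countable) auto
  then have "AE \<omega> in M. norm (overshoot X b \<omega> powr k) \<le> a powr k"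
  proof eventually_elim
    case (elim \<omega>)
    then have "overshoot X b \<omega> \<le> a" using assms(3,4) by (intro overshoot_le) auto
    then show ?case using assms(6) overshoot_nonneg[of X b \<omega>] by (simp add: powr_mono2)
  qed
  then have int: "integrable M (\<lambda>\<omega>. overshoot X b \<omega> powr k)"
    by (rule integrable_const_bound) measurable
  have A: "?A \<in> events" by measurable
  have "prob ?A * (c - b) powr k = (\<integral>\<omega>. indicator ?A \<omega> * (c - b) powr k \<partial>M)"
    by (simp add: Int_absorb2)
  also have "\<dots> \<le> expectation (\<lambda>\<omega>. overshoot X b \<omega> powr k)"
  proof (rule integral_mono[OF _ int])
    show "indicator ?A \<omega> * (c - b) powr k \<le> overshoot X b \<omega> powr k" for \<omega>
      using assms overshoot_first_step[of b X \<omega>]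
      by (auto simp: indicator_def intro!: powr_mono2)
    show "integrable M (\<lambda>\<omega>. indicator ?A \<omega> * (c - b) powr k)"
      using A by (intro integrable_mult_left integrable_real_indicator) (auto simp: emeasure_eq_measure)
  qed
  finally show ?thesis .
qed

lemma (in prob_space) expectation_pos_part_powr_le:
  fixes Y :: "'a \<Rightarrow> real"
  assumes [measurable]: "Y \<in> borel_measurable M" and "AE \<omega> in M. Y \<omega> \<le> a" "0 \<le> a" "0 \<le> r"
  shows "expectation (\<lambda>\<omega>. max (Y \<omega>) 0 powr r) \<le> a powr r"
proof -
  have le: "AE \<omega> in M. max (Y \<omega>) 0 powr r \<le> a powr r"
    using assms(2) by eventually_elim (use assms in \<open>simp add: powr_mono2\<close>)
  then have "integrable M (\<lambda>\<omega>. max (Y \<omega>) 0 powr r)"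
    by (intro integrable_const_bound[where B="a powr r"]) auto
  then show ?thesis using le by (rule integral_le_const)
qed

theorem proposition5:
  fixes P :: "real \<Rightarrow> 'a measure" and X :: "nat \<Rightarrow> 'a \<Rightarrow> real"
  assumes prob: "\<And>\<theta>. \<theta> \<ge> 0 \<Longrightarrow> prob_space (P \<theta>)"
    and indep: "\<And>\<theta>. \<theta> \<ge> 0 \<Longrightarrow> prob_space.indep_vars (P \<theta>) (\<lambda>_. borel) X {1..}"
    and law: "\<And>\<theta> n. \<theta> \<ge> 0 \<Longrightarrow> n \<ge> 1 \<Longrightarrow> distr (P \<theta>) borel (X n) = exp_tilt F0 \<theta>"
  shows "\<forall>k::real. k > 1 \<longrightarrow>
    (\<exists>b \<in> {0<..<sqrt 3}. \<exists>\<theta>0 > 0. \<forall>\<theta> \<ge> \<theta>0.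
      \<not> ((\<integral>\<omega>. overshoot X b \<omega> powr k \<partial>P \<theta>)
          \<le> (\<integral>\<omega>. (max (X 1 \<omega>) 0) powr (k + 1) \<partial>P \<theta>) / (k * (\<integral>\<omega>. X 1 \<omega> \<partial>P \<theta>))))"
proof (intro allI impI)
  fix k :: real assume k: "1 < k"
  define a :: real where "a = sqrt 3"
  have a: "0 < a" by (simp add: a_def)
  obtain b where b: "0 < b" "b < a" "a powr k < k * (a - b) powr k"
    using exists_level[OF k a] .
  obtain t where t: "0 < t" "t < 1" "t < a - b" "0 < (a - t) * (1 - t) - a * t"
    "a powr (k + 1) < k * ((1 - t) * (a - t - b) powr k) * ((a - t) * (1 - t) - a * t)"
    using exists_concentration[OF b(2) a b(3)] .
  \<comment> \<open>From \<open>\<theta>0\<close> on, the increment law puts mass at most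
    \<open>t\<close> on \<open>{..a - t}\<close>; the same \<open>t\<close> serves as distance and
    as mass.\<close>
  obtain \<theta>0 where \<theta>0: "0 < \<theta>0"
    "\<And>\<theta>. \<theta>0 \<le> \<theta> \<Longrightarrow> emeasure (exp_tilt F0 \<theta>) {..a - t} \<le> ennreal t"
    using exp_tilt_F0_concentrates[of "a - t" t] t(1) unfolding a_def by auto
  have "\<not> (\<integral>\<omega>. overshoot X b \<omega> powr k \<partial>P \<theta>)
      \<le> (\<integral>\<omega>. (max (X 1 \<omega>) 0) powr (k + 1) \<partial>P \<theta>) / (k * (\<integral>\<omega>. X 1 \<omega> \<partial>P \<theta>))"
    if "\<theta>0 \<le> \<theta>" for \<theta>
  proof -
    have \<theta>: "0 \<le> \<theta>" using that \<theta>0(1) by simp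
    interpret prob_space "P \<theta>" using prob[OF \<theta>] .
    \<comment> \<open>Measurability of each variable is part of the definition of
      \<open>indep_vars\<close>.\<close>
    have X: "X n \<in> borel_measurable (P \<theta>)" if "1 \<le> n" for n
      using indep[OF \<theta>] that by (auto simp: indep_vars_def)
    have X1 [measurable]: "X 1 \<in> borel_measurable (P \<theta>)" using X by blast
    have bd: "AE \<omega> in P \<theta>. \<bar>X n \<omega>\<bar> \<le> a" if "1 \<le> n" for n
    proof -
      have "AE x in distr (P \<theta>) borel (X n). \<bar>x\<bar> \<le> a"
        unfolding law[OF \<theta> that] a_def by (rule AE_exp_tilt_F0)
      then show ?thesis using X[OF that] by (subst (asm) AE_distr_iff) auto
    qed
    then have bd': "AE \<omega> in P \<theta>. X n \<omega> \<le> a" if "1 \<le> n" for n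
      using that by fastforce
    \<comment> \<open>\<open>m\<close> and \<open>E\<close> are the explicit lower bounds for the
      mean and for the overshoot moment \<open>L\<close>; \<open>R\<close> is the positive-part
      moment.\<close>
    define m where "m = (a - t) * (1 - t) - a * t"
    define E where "E = (1 - t) * (a - t - b) powr k"
    define L where "L = expectation (\<lambda>\<omega>. overshoot X b \<omega> powr k)"
    define R where "R = expectation (\<lambda>\<omega>. (max (X 1 \<omega>) 0) powr (k + 1))"
    have "emeasure (P \<theta>) {\<omega> \<in> space (P \<theta>). X 1 \<omega> \<le> a - t} = emeasure (exp_tilt F0 \<theta>) {..a - t}"
      unfolding law[OF \<theta> order_refl, symmetric]
      by (subst emeasure_distr[OF X1]) (auto intro!: arg_cong[where f="emeasure (P \<theta>)"])
    then have "prob {\<omega> \<in> space (P \<theta>). X 1 \<omega> \<le> a - t} \<le> t"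
      using \<theta>0(2)[OF that] t(1) by (simp add: emeasure_eq_measure flip: ennreal_le_iff)
    moreover have "prob {\<omega> \<in> space (P \<theta>). \<not> X 1 \<omega> \<le> a - t} = 1 - prob {\<omega> \<in> space (P \<theta>). X 1 \<omega> \<le> a - t}"
      by (rule prob_neg) measurable
    ultimately have p: "1 - t \<le> prob {\<omega> \<in> space (P \<theta>). a - t < X 1 \<omega>}"
      by (simp add: not_le)
    have \<mu>: "m \<le> expectation (X 1)"
      using expectation_ge_of_concentrated[OF X1 bd[OF order_refl] _ p] t b by (simp add: m_def)
    have "E \<le> prob {\<omega> \<in> space (P \<theta>). a - t < X 1 \<omega>} * (a - t - b) powr k"
      unfolding E_def using p by (intro mult_right_mono) auto
    also have "\<dots> \<le> L"
      unfolding L_def using X bd' a b t k by (intro expectation_overshoot_powr_ge) auto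
    finally have L: "E \<le> L" .
    have E: "0 \<le> E" using t by (simp add: E_def)
    have m: "0 < m" using t by (simp add: m_def)
    \<comment> \<open>The quotient is compared in product form: \<open>R\<close> is at most
      \<open>a powr (k + 1)\<close>, which lies strictly below \<open>k * E * m\<close> by the
      choice of \<open>t\<close>.\<close>
    have "R \<le> a powr (k + 1)"
      unfolding R_def using X1 bd' a k by (intro expectation_pos_part_powr_le) auto
    also have "\<dots> < k * E * m" using t(5) by (simp add: E_def m_def)
    also have "\<dots> \<le> k * L * expectation (X 1)"
      using k L \<mu> E m by (intro mult_mono) auto
    finally have "R < L * (k * expectation (X 1))" by (simp add: mult_ac)
    \<comment> \<open>Dividing keeps the strict inequality because the mean is at least
      \<open>m > 0\<close>.\<close>
    then have "R / (k * expectation (X 1)) < L"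
      using k \<mu> m by (subst pos_divide_less_eq) auto
    then show ?thesis by (simp add: L_def R_def)
  qed
  then show "\<exists>b \<in> {0<..<sqrt 3}. \<exists>\<theta>0 > 0. \<forall>\<theta> \<ge> \<theta>0.
      \<not> ((\<integral>\<omega>. overshoot X b \<omega> powr k \<partial>P \<theta>)
          \<le> (\<integral>\<omega>. (max (X 1 \<omega>) 0) powr (k + 1) \<partial>P \<theta>) / (k * (\<integral>\<omega>. X 1 \<omega> \<partial>P \<theta>)))"
    using \<theta>0(1) b by (intro bexI[of _ b] exI[of _ \<theta>0]) (auto simp: a_def)
qed

end
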